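(* Let $\Gamma$ be a set of formulas and $A$ a formula. (1) If $\Gamma \vdash_{\mathsf{NK}} A$, then $\Gamma^{\mathsf{m}} \vdash_{\mathsf{D}} \lnot\lnot A^{\mathsf{m}}$ and $\Gamma^{\mathsf{m}}, \lnot A^{\mathsf{m}} \vdash_{\mathsf{D}} \bot$, where $\mathsf{D} = \mathsf{NM}\setminus\{\to_\mathsf{i},\to_\mathsf{e},\forall_\mathsf{i},\forall_\mathsf{e}\}$. (2) If $\to$ and $\forall$ occur neither in $A$ nor in any formula of $\Gamma$, then the following are equivalent: (a) $\Gamma\vdash_{\mathsf{NK}} A$; (b) $\Gamma\vdash_{\mathsf{NM}}\lnot\lnot A$; (c) $\Gamma,\lnot A\vdash_{\mathsf{NM}}\bot$. If moreover $A=\lnot B$, then $\Gamma\vdash_{\mathsf{NK}}\lnot B$ if and only if $\Gamma\vdash_{\mathsf{NM}}\lnot B$.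
   Context: First-order language with connectives $\top,\bot,\lnot,\land,\lor,\to$ and quantifiers $\forall,\exists$; negation $\lnot$ is primitive (not an abbreviation of $A\to\bot$). Natural deduction rules: $\mathsf{raa}$ (from $\bot$ infer $A$, discharging any number, possibly zero, of assumptions $\lnot A$); $\mathsf{efq}$ (from $\bot$ infer $A$); $\top_\mathsf{i}$; $\lnot_\mathsf{i}$ (from $\bot$ infer $\lnot A$ discharging $A$); $\lnot_\mathsf{e}$ (from $\lnot A$ and $A$ infer $\bot$); and the usual Prawitz-style rules $\to_\mathsf{i}$, $\to_\mathsf{e}$, $\land_\mathsf{i}$, $\land_{\mathsf{e}_1}$, $\land_{\mathsf{e}_2}$, $\lor_{\mathsf{i}_1}$, $\lor_{\mathsf{i}_2}$, $\lor_\mathsf{e}$, $\forall_\mathsf{i}$, $\forall_\mathsf{e}$, $\exists_\mathsf{i}$, $\exists_\mathsf{e}$ (discharging rules may discharge any number of assumptions). $\mathsf{NM}$ (minimal logic) is the set of all these rules except $\mathsf{raa}$ and $\mathsf{efq}$; $\mathsf{NK}=\mathsf{NM}\cup\{\mathsf{raa}\}$ (classical logic). $\Gamma\vdash_{\mathsf{D}} A$ means there is a derivation using only rules of $\mathsf{D}$, with conclusion $A$, all of whose undischarged assumptions are occurrences of formulas in $\Gamma$. The translation $(\cdot)^{\mathsf{m}}$ is defined by induction: atomic formulas, $\top$, $\bot$ unchanged; $(A\land B)^{\mathsf{m}}=A^{\mathsf{m}}\land B^{\mathsf{m}}$; $(A\lor B)^{\mathsf{m}}=A^{\mathsf{m}}\lor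 B^{\mathsf{m}}$; $(\lnot A)^{\mathsf{m}}=\lnot A^{\mathsf{m}}$; $(A\to B)^{\mathsf{m}}=\lnot A^{\mathsf{m}}\lor B^{\mathsf{m}}$; $(\forall x A)^{\mathsf{m}}=\lnot\exists x\lnot A^{\mathsf{m}}$; $(\exists x A)^{\mathsf{m}}=\exists x A^{\mathsf{m}}$; and $\Gamma^{\mathsf{m}}=\{A^{\mathsf{m}}\mid A\in\Gamma\}$. *)

theory Defs
  imports Main
begin

text \<open>
  Syntax is in de Bruijn form, so formulas are identified up to renaming of bound variables.
  A free variable is an index pointing beyond the enclosing quantifiers: under \<open>k\<close> quantifiers,
  the free variable \<open>i\<close> appears as index \<open>k + i\<close>.
\<close>

datatype 'f tm = Var nat | Fun 'f "'f tm list"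

datatype ('f, 'p) fm =
    Atom 'p "'f tm list"
  | Top
  | Bot
  | Neg "('f, 'p) fm"
  | Conj "('f, 'p) fm" "('f, 'p) fm"
  | Disj "('f, 'p) fm" "('f, 'p) fm"
  | Imp "('f, 'p) fm" "('f, 'p) fm"
  | Forall "('f, 'p) fm"
  | Exists "('f, 'p) fm"

text \<open>
  A first-order language is given by its function symbols and its predicate symbols, each with
  its arity. Either set may be empty.
\<close>

type_synonym ('f, 'p) language = "('f \<times> nat) set \<times> ('p \<times> nat) set"

fun is_term :: "('f, 'p) language \<Rightarrow> 'f tm \<Rightarrow> bool" where
  "is_term L (Var i) = True"
| "is_term L (Fun f ts) = ((f, length ts) \<in> fst L \<and> (\<forall>t \<in> set ts. is_term L t))"

fun is_formula :: "('f, 'p) language \<Rightarrow> ('f, 'p) fm \<Rightarrow> bool" where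
  "is_formula L (Atom p ts) = ((p, length ts) \<in> snd L \<and> (\<forall>t \<in> set ts. is_term L t))"
| "is_formula L Top = True"
| "is_formula L Bot = True"
| "is_formula L (Neg A) = is_formula L A"
| "is_formula L (Conj A B) = (is_formula L A \<and> is_formula L B)"
| "is_formula L (Disj A B) = (is_formula L A \<and> is_formula L B)"
| "is_formula L (Imp A B) = (is_formula L A \<and> is_formula L B)"
| "is_formula L (Forall A) = is_formula L A"
| "is_formula L (Exists A) = is_formula L A"

fun fv_tm :: "'f tm \<Rightarrow> nat set" where
  "fv_tm (Var i) = {i}"
| "fv_tm (Fun f ts) = (\<Union>t \<in> set ts. fv_tm t)"

fun fv :: "('f, 'p) fm \<Rightarrow> nat set" where
  "fv (Atom p ts) = (\<Union>t \<in> set ts. fv_tm t)"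
| "fv Top = {}"
| "fv Bot = {}"
| "fv (Neg A) = fv A"
| "fv (Conj A B) = fv A \<union> fv B"
| "fv (Disj A B) = fv A \<union> fv B"
| "fv (Imp A B) = fv A \<union> fv B"
| "fv (Forall A) = {i. Suc i \<in> fv A}"
| "fv (Exists A) = {i. Suc i \<in> fv A}"

fun lift_tm :: "'f tm \<Rightarrow> 'f tm" where
  "lift_tm (Var i) = Var (Suc i)"
| "lift_tm (Fun f ts) = Fun f (map lift_tm ts)"

text \<open>
  Capture-avoiding replacement of the index \<open>k\<close> by a term; the indices above \<open>k\<close> are
  decremented, since the quantifier binding \<open>k\<close> is removed.
\<close>

fun subst_tm :: "nat \<Rightarrow> 'f tm \<Rightarrow> 'f tm \<Rightarrow> 'f tm" where
  "subst_tm k s (Var i) = (if i < k then Var i else if i = k then s else Var (i - 1))"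
| "subst_tm k s (Fun f ts) = Fun f (map (subst_tm k s) ts)"

fun subst :: "nat \<Rightarrow> 'f tm \<Rightarrow> ('f, 'p) fm \<Rightarrow> ('f, 'p) fm" where
  "subst k s (Atom p ts) = Atom p (map (subst_tm k s) ts)"
| "subst k s Top = Top"
| "subst k s Bot = Bot"
| "subst k s (Neg A) = Neg (subst k s A)"
| "subst k s (Conj A B) = Conj (subst k s A) (subst k s B)"
| "subst k s (Disj A B) = Disj (subst k s A) (subst k s B)"
| "subst k s (Imp A B) = Imp (subst k s A) (subst k s B)"
| "subst k s (Forall A) = Forall (subst (Suc k) (lift_tm s) A)"
| "subst k s (Exists A) = Exists (subst (Suc k) (lift_tm s) A)"

text \<open>\<open>inst A t\<close> is \<open>A[t/x]\<close>, where \<open>x\<close> is the variable bound in \<open>Forall A\<close> or \<open>Exists A\<close>.\<close>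

definition inst :: "('f, 'p) fm \<Rightarrow> 'f tm \<Rightarrow> ('f, 'p) fm" where
  "inst A t = subst 0 t A"

datatype rule =
    RAA | EFQ | TopI | NegI | NegE | ImpI | ImpE
  | ConjI | ConjE1 | ConjE2 | DisjI1 | DisjI2 | DisjE
  | ForallI | ForallE | ExistsI | ExistsE

definition NM :: "rule set" where
  "NM = UNIV - {RAA, EFQ}"

definition NK :: "rule set" where
  "NK = NM \<union> {RAA}"

text \<open>
  If \<open>\<Delta>\<close> is the set of open assumptions of a derivation, then discharging any number of
  occurrences of \<open>A\<close>, possibly none or not all of them, leaves one of the following sets.
\<close>

definition discharge :: "('f, 'p) fm \<Rightarrow> ('f, 'p) fm set \<Rightarrow> ('f, 'p) fm set set" where
  "discharge A \<Delta> = {\<Delta>, \<Delta> - {A}}"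

text \<open>
  \<open>derivation L R \<Delta> A\<close>: there is a derivation in the language \<open>L\<close>, using only rules of \<open>R\<close>, with
  conclusion \<open>A\<close>, and \<open>\<Delta>\<close> is exactly the set of formulas occurring in it as undischarged
  assumptions. The conditions \<open>is_formula\<close> and \<open>is_term\<close> ensure that all formulas of the
  derivation belong to \<open>L\<close>. In \<open>forall_i\<close> and \<open>exists_e\<close>, the variable \<open>y\<close> is the eigenvariable.
\<close>

inductive derivation ::
  "('f, 'p) language \<Rightarrow> rule set \<Rightarrow> ('f, 'p) fm set \<Rightarrow> ('f, 'p) fm \<Rightarrow> bool"
  for L :: "('f, 'p) language" and R :: "rule set"
where
  assumption: "is_formula L A \<Longrightarrow> derivation L R {A} A"
| raa: "RAA \<in> R \<Longrightarrow> is_formula L A \<Longrightarrow> derivation L R \<Delta> Bot \<Longrightarrow> \<Delta>' \<in> discharge (Neg A) \<Delta>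
    \<Longrightarrow> derivation L R \<Delta>' A"
| efq: "EFQ \<in> R \<Longrightarrow> is_formula L A \<Longrightarrow> derivation L R \<Delta> Bot \<Longrightarrow> derivation L R \<Delta> A"
| top_i: "TopI \<in> R \<Longrightarrow> derivation L R {} Top"
| neg_i: "NegI \<in> R \<Longrightarrow> is_formula L A \<Longrightarrow> derivation L R \<Delta> Bot \<Longrightarrow> \<Delta>' \<in> discharge A \<Delta>
    \<Longrightarrow> derivation L R \<Delta>' (Neg A)"
| neg_e: "NegE \<in> R \<Longrightarrow> derivation L R \<Delta>1 (Neg A) \<Longrightarrow> derivation L R \<Delta>2 A
    \<Longrightarrow> derivation L R (\<Delta>1 \<union> \<Delta>2) Bot"
| imp_i: "ImpI \<in> R \<Longrightarrow> is_formula L A \<Longrightarrow> derivation L R \<Delta> B \<Longrightarrow> \<Delta>' \<in> discharge A \<Delta>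
    \<Longrightarrow> derivation L R \<Delta>' (Imp A B)"
| imp_e: "ImpE \<in> R \<Longrightarrow> derivation L R \<Delta>1 (Imp A B) \<Longrightarrow> derivation L R \<Delta>2 A
    \<Longrightarrow> derivation L R (\<Delta>1 \<union> \<Delta>2) B"
| conj_i: "ConjI \<in> R \<Longrightarrow> derivation L R \<Delta>1 A \<Longrightarrow> derivation L R \<Delta>2 B
    \<Longrightarrow> derivation L R (\<Delta>1 \<union> \<Delta>2) (Conj A B)"
| conj_e1: "ConjE1 \<in> R \<Longrightarrow> derivation L R \<Delta> (Conj A B) \<Longrightarrow> derivation L R \<Delta> A"
| conj_e2: "ConjE2 \<in> R \<Longrightarrow> derivation L R \<Delta> (Conj A B) \<Longrightarrow> derivation L R \<Delta> B"
| disj_i1: "DisjI1 \<in> R \<Longrightarrow> is_formula L B \<Longrightarrow> derivation L R \<Delta> A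
    \<Longrightarrow> derivation L R \<Delta> (Disj A B)"
| disj_i2: "DisjI2 \<in> R \<Longrightarrow> is_formula L A \<Longrightarrow> derivation L R \<Delta> B
    \<Longrightarrow> derivation L R \<Delta> (Disj A B)"
| disj_e: "DisjE \<in> R \<Longrightarrow> derivation L R \<Delta> (Disj A B)
    \<Longrightarrow> derivation L R \<Delta>1 C \<Longrightarrow> \<Delta>1' \<in> discharge A \<Delta>1
    \<Longrightarrow> derivation L R \<Delta>2 C \<Longrightarrow> \<Delta>2' \<in> discharge B \<Delta>2
    \<Longrightarrow> derivation L R (\<Delta> \<union> \<Delta>1' \<union> \<Delta>2') C"
| forall_i: "ForallI \<in> R \<Longrightarrow> derivation L R \<Delta> (inst A (Var y))
    \<Longrightarrow> y \<notin> fv (Forall A) \<Longrightarrow> (\<forall>B \<in> \<Delta>. y \<notin> fv B)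
    \<Longrightarrow> derivation L R \<Delta> (Forall A)"
| forall_e: "ForallE \<in> R \<Longrightarrow> is_term L t \<Longrightarrow> derivation L R \<Delta> (Forall A)
    \<Longrightarrow> derivation L R \<Delta> (inst A t)"
| exists_i: "ExistsI \<in> R \<Longrightarrow> is_term L t \<Longrightarrow> derivation L R \<Delta> (inst A t)
    \<Longrightarrow> derivation L R \<Delta> (Exists A)"
| exists_e: "ExistsE \<in> R \<Longrightarrow> derivation L R \<Delta>1 (Exists A)
    \<Longrightarrow> derivation L R \<Delta>2 C \<Longrightarrow> \<Delta>2' \<in> discharge (inst A (Var y)) \<Delta>2
    \<Longrightarrow> y \<notin> fv (Exists A) \<Longrightarrow> y \<notin> fv C \<Longrightarrow> (\<forall>B \<in> \<Delta>2'. y \<notin> fv B)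
    \<Longrightarrow> derivation L R (\<Delta>1 \<union> \<Delta>2') C"

definition derivable ::
  "('f, 'p) language \<Rightarrow> rule set \<Rightarrow> ('f, 'p) fm set \<Rightarrow> ('f, 'p) fm \<Rightarrow> bool" where
  "derivable L R \<Gamma> A \<longleftrightarrow> (\<exists>\<Delta> \<subseteq> \<Gamma>. derivation L R \<Delta> A)"

fun mtrans :: "('f, 'p) fm \<Rightarrow> ('f, 'p) fm" where
  "mtrans (Atom p ts) = Atom p ts"
| "mtrans Top = Top"
| "mtrans Bot = Bot"
| "mtrans (Neg A) = Neg (mtrans A)"
| "mtrans (Conj A B) = Conj (mtrans A) (mtrans B)"
| "mtrans (Disj A B) = Disj (mtrans A) (mtrans B)"
| "mtrans (Imp A B) = Disj (Neg (mtrans A)) (mtrans B)"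
| "mtrans (Forall A) = Neg (Exists (Neg (mtrans A)))"
| "mtrans (Exists A) = Exists (mtrans A)"

fun imp_forall_free :: "('f, 'p) fm \<Rightarrow> bool" where
  "imp_forall_free (Atom p ts) = True"
| "imp_forall_free Top = True"
| "imp_forall_free Bot = True"
| "imp_forall_free (Neg A) = imp_forall_free A"
| "imp_forall_free (Conj A B) = (imp_forall_free A \<and> imp_forall_free B)"
| "imp_forall_free (Disj A B) = (imp_forall_free A \<and> imp_forall_free B)"
| "imp_forall_free (Imp A B) = False"
| "imp_forall_free (Forall A) = False"
| "imp_forall_free (Exists A) = imp_forall_free A"

end

theory Submission
  imports Defs
begin

text \<open>
  By induction on an \<open>NK\<close>-derivation, a double negation can be put in front of the translated
  conclusion. The point is that \<open>\<not>\<not>\<close> behaves as a monad towards \<open>\<bottom>\<close>: to refute a context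
  proving \<open>\<not>\<not>A\<close> one may assume \<open>A\<close>. This makes every introduction and elimination rule
  survive the translation, and reduces \<open>raa\<close> to \<open>\<not>\<^sub>i\<close>. The rule \<open>\<forall>\<^sub>i\<close>, which fails under a double
  negation in minimal logic, becomes harmless since \<open>\<not>\<exists>x\<not>A\<close> is introduced by refuting \<open>\<not>A\<close> for
  an eigenvariable.
\<close>

section \<open>Well-formedness, free variables and substitution under the translation\<close>

lemma is_term_lift_tm [simp]: "is_term L (lift_tm t) = is_term L t"
  by (induction t) auto

lemma is_term_subst_tm [simp]: "is_term L s \<Longrightarrow> is_term L (subst_tm k s t) = is_term L t"
  by (induction t) auto

lemma is_formula_subst [simp]: "is_term L s \<Longrightarrow> is_formula L (subst k s A) = is_formula L A"
  by (induction A arbitrary: k s) auto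

lemma is_formula_inst [simp]: "is_term L t \<Longrightarrow> is_formula L (inst A t) = is_formula L A"
  by (simp add: inst_def)

lemma is_formula_mtrans [simp]: "is_formula L (mtrans A) = is_formula L A"
  by (induction A) auto

lemma fv_mtrans [simp]: "fv (mtrans A) = fv A"
  by (induction A) auto

lemma mtrans_subst: "mtrans (subst k s A) = subst k s (mtrans A)"
  by (induction A arbitrary: k s) auto

lemma mtrans_inst [simp]: "mtrans (inst A t) = inst (mtrans A) t"
  by (simp add: inst_def mtrans_subst)

lemma inst_Neg [simp]: "inst (Neg A) t = Neg (inst A t)"
  by (simp add: inst_def)

lemma mtrans_imp_forall_free: "imp_forall_free A \<Longrightarrow> mtrans A = A"
  by (induction A) auto

section \<open>Structural properties and context-style forms of the rules\<close>

lemma derivation_is_formula: "derivation L R \<Delta> A \<Longrightarrow> is_formula L A"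
  by (induction rule: derivation.induct) auto

lemma derivation_mono_rules: "derivation L R \<Delta> A \<Longrightarrow> R \<subseteq> S \<Longrightarrow> derivation L S \<Delta> A"
  by (induction rule: derivation.induct) (blast intro: derivation.intros)+

lemma derivableI: "derivation L R \<Delta> A \<Longrightarrow> \<Delta> \<subseteq> \<Gamma> \<Longrightarrow> derivable L R \<Gamma> A"
  unfolding derivable_def by blast

lemma derivable_mono_rules: "derivable L R \<Gamma> A \<Longrightarrow> R \<subseteq> S \<Longrightarrow> derivable L S \<Gamma> A"
  unfolding derivable_def by (blast intro: derivation_mono_rules)

lemma derivable_weaken: "derivable L R \<Gamma> A \<Longrightarrow> \<Gamma> \<subseteq> \<Gamma>' \<Longrightarrow> derivable L R \<Gamma>' A"
  unfolding derivable_def by blast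

lemma derivable_assumption: "A \<in> \<Gamma> \<Longrightarrow> is_formula L A \<Longrightarrow> derivable L R \<Gamma> A"
  unfolding derivable_def by (blast intro: assumption)

text \<open>Whether or not the discharge is vacuous, at most \<open>A\<close> disappears. The
  induction below uses this to put the discharged formula back into the context of an induction
  hypothesis.\<close>

lemma discharge_superset: "\<Delta>' \<in> discharge A \<Delta> \<Longrightarrow> \<Delta> \<subseteq> insert A \<Delta>'"
  by (auto simp: discharge_def)

text \<open>When a derivation is built, all occurrences of \<open>A\<close> are discharged: this
  leaves a subset of \<Gamma> even if \<open>A\<close> is not in \<Gamma>. Vacuous discharge is
  covered, since then nothing is removed.\<close>

lemma diff_in_discharge: "\<Delta> - {A} \<in> discharge A \<Delta>"
  by (simp add: discharge_def)

lemma derivable_raa: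
  assumes "RAA \<in> R" "is_formula L A" "derivable L R (insert (Neg A) \<Gamma>) Bot"
  shows "derivable L R \<Gamma> A"
proof -
  obtain \<Delta> where "\<Delta> \<subseteq> insert (Neg A) \<Gamma>" "derivation L R \<Delta> Bot"
    using assms(3) by (auto simp: derivable_def)
  then show ?thesis
    by (intro derivableI[OF derivation.raa[OF assms(1,2) _ diff_in_discharge]]) auto
qed

lemma derivable_neg_i:
  assumes "NegI \<in> R" "is_formula L A" "derivable L R (insert A \<Gamma>) Bot"
  shows "derivable L R \<Gamma> (Neg A)"
proof -
  obtain \<Delta> where "\<Delta> \<subseteq> insert A \<Gamma>" "derivation L R \<Delta> Bot"
    using assms(3) by (auto simp: derivable_def)
  then show ?thesis
    by (intro derivableI[OF derivation.neg_i[OF assms(1,2) _ diff_in_discharge]]) auto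
qed

lemma derivable_neg_e:
  assumes "NegE \<in> R" "derivable L R \<Gamma> (Neg A)" "derivable L R \<Gamma> A"
  shows "derivable L R \<Gamma> Bot"
  using assms unfolding derivable_def by (meson derivation.neg_e Un_least)

lemma derivable_disj_i1:
  "DisjI1 \<in> R \<Longrightarrow> is_formula L B \<Longrightarrow> derivable L R \<Gamma> A \<Longrightarrow> derivable L R \<Gamma> (Disj A B)"
  unfolding derivable_def by (blast intro: derivation.disj_i1)

lemma derivable_disj_e:
  assumes "DisjE \<in> R" "derivable L R \<Gamma> (Disj A B)"
    "derivable L R (insert A \<Gamma>) C" "derivable L R (insert B \<Gamma>) C"
  shows "derivable L R \<Gamma> C"
proof -
  obtain \<Delta> \<Delta>1 \<Delta>2 where "\<Delta> \<subseteq> \<Gamma>" "\<Delta>1 \<subseteq> insert A \<Gamma>" "\<Delta>2 \<subseteq> insert B \<Gamma>"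
    and d: "derivation L R \<Delta> (Disj A B)" "derivation L R \<Delta>1 C" "derivation L R \<Delta>2 C"
    using assms(2-4) by (auto simp: derivable_def)
  then have "\<Delta> \<union> (\<Delta>1 - {A}) \<union> (\<Delta>2 - {B}) \<subseteq> \<Gamma>"
    by blast
  then show ?thesis
    using derivation.disj_e[OF assms(1) d(1,2) diff_in_discharge d(3) diff_in_discharge]
    by (intro derivableI)
qed

text \<open>The eigenvariable condition restricts only the open assumptions of the minor premise.
  These are therefore collected in a separate \<Gamma>', while \<open>y\<close> may occur free in
  the rest of \<Gamma>, on which the major premise depends.\<close>

lemma derivable_exists_e:
  assumes "ExistsE \<in> R" "derivable L R \<Gamma> (Exists A)"
    "derivable L R (insert (inst A (Var y)) \<Gamma>') C"
    "y \<notin> fv (Exists A)" "y \<notin> fv C" "\<forall>B \<in> \<Gamma>'. y \<notin> fv B" "\<Gamma>' \<subseteq> \<Gamma>"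
  shows "derivable L R \<Gamma> C"
proof -
  obtain \<Delta>1 \<Delta>2 where sub: "\<Delta>1 \<subseteq> \<Gamma>" "\<Delta>2 \<subseteq> insert (inst A (Var y)) \<Gamma>'"
    and d: "derivation L R \<Delta>1 (Exists A)" "derivation L R \<Delta>2 C"
    using assms(2,3) by (auto simp: derivable_def)
  have "\<forall>B \<in> \<Delta>2 - {inst A (Var y)}. y \<notin> fv B"
    using sub(2) assms(6) by blast
  moreover have "\<Delta>1 \<union> (\<Delta>2 - {inst A (Var y)}) \<subseteq> \<Gamma>"
    using sub assms(7) by blast
  ultimately show ?thesis
    using derivation.exists_e[OF assms(1) d diff_in_discharge assms(4,5)]
    by (intro derivableI)
qed

section \<open>Double negations in minimal logic\<close>

lemma derivable_refute:
  assumes "NegE \<in> R" "Neg A \<in> \<Gamma>" "is_formula L A" "derivable L R \<Gamma> A"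
  shows "derivable L R \<Gamma> Bot"
  using assms derivable_assumption[of "Neg A" \<Gamma> L R] by (auto intro: derivable_neg_e)

lemma derivable_refute_assumption:
  assumes "NegE \<in> R" "Neg A \<in> \<Gamma>" "A \<in> \<Gamma>" "is_formula L A"
  shows "derivable L R \<Gamma> Bot"
  using assms by (auto intro: derivable_refute derivable_assumption)

text \<open>A refutation of \<open>A\<close> gives \<open>Neg A\<close>, which contradicts
  \<open>Neg (Neg A)\<close>. The context may grow from \<Gamma> to \<Gamma>', so that an induction
  hypothesis, known only over its own assumptions, can be unwrapped inside a larger context.\<close>

lemma derivable_neg_neg_bind:
  assumes "{NegI, NegE} \<subseteq> R" "is_formula L A" "derivable L R \<Gamma> (Neg (Neg A))" "\<Gamma> \<subseteq> \<Gamma>'"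
    "derivable L R (insert A \<Gamma>') Bot"
  shows "derivable L R \<Gamma>' Bot"
  using assms derivable_neg_i[of R L A \<Gamma>'] derivable_weaken[OF assms(3,4)]
  by (auto intro: derivable_neg_e)

text \<open>The assumption \<open>Bot\<close> is already the refutation that the bind asks for, so
  no ex falso is involved.\<close>

lemma derivable_neg_neg_Bot:
  assumes "{NegI, NegE} \<subseteq> R" "derivable L R \<Gamma> (Neg (Neg Bot))"
  shows "derivable L R \<Gamma> Bot"
  by (rule derivable_neg_neg_bind[OF assms(1) _ assms(2)]) (auto intro: derivable_assumption)

text \<open>Forwards, the added \<open>Neg A\<close> refutes the \<open>A\<close> that the bind
  supplies; backwards is a single negation introduction. The right-hand side is the convenient form
  of a goal, since binds apply once the conclusion is \<open>Bot\<close>.\<close>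

lemma derivable_neg_neg_iff:
  assumes "{NegI, NegE} \<subseteq> R" "is_formula L A"
  shows "derivable L R \<Gamma> (Neg (Neg A)) \<longleftrightarrow> derivable L R (insert (Neg A) \<Gamma>) Bot"
proof
  assume "derivable L R \<Gamma> (Neg (Neg A))"
  then show "derivable L R (insert (Neg A) \<Gamma>) Bot"
    by (rule derivable_neg_neg_bind[OF assms])
      (use assms in \<open>auto intro: derivable_refute_assumption\<close>)
next
  assume "derivable L R (insert (Neg A) \<Gamma>) Bot"
  then show "derivable L R \<Gamma> (Neg (Neg A))"
    using assms by (auto intro: derivable_neg_i)
qed

text \<open>Assume \<open>A\<close>. The bind reduces the triple negation to \<open>Neg A\<close>,
  which this assumption contradicts. Hence a negated conclusion needs no further double
  negation.\<close>

lemma derivable_neg_neg_neg: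
  assumes "{NegI, NegE} \<subseteq> R" "is_formula L A" "derivable L R \<Gamma> (Neg (Neg (Neg A)))"
  shows "derivable L R \<Gamma> (Neg A)"
proof (rule derivable_neg_i)
  show "derivable L R (insert A \<Gamma>) Bot"
    by (rule derivable_neg_neg_bind[OF assms(1) _ assms(3)])
      (use assms in \<open>auto intro: derivable_refute_assumption\<close>)
qed (use assms in auto)

section \<open>Translating classical derivations into the fragment \<open>D\<close>\<close>

abbreviation D :: "rule set" where
  "D \<equiv> NM - {ImpI, ImpE, ForallI, ForallE}"

lemma NegI_NegE_in_D: "{NegI, NegE} \<subseteq> D"
  by (simp add: NM_def)

lemmas D_neg_neg_bind = derivable_neg_neg_bind[OF NegI_NegE_in_D]

lemma in_D: "NegI \<in> D" "NegE \<in> D" "TopI \<in> D" "ConjI \<in> D" "ConjE1 \<in> D" "ConjE2 \<in> D"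
  "DisjI1 \<in> D" "DisjI2 \<in> D" "DisjE \<in> D" "ExistsI \<in> D" "ExistsE \<in> D"
  by (simp_all add: NM_def)

text \<open>The statement is about the exact set of open assumptions, so that the induction can
  follow the rules one by one. In most cases the goal is turned into refuting the negated
  conclusion, and the hypotheses are unwrapped by \<open>D_neg_neg_bind\<close>, innermost
  assumption first.\<close>

lemma derivation_NK_mtrans:
  assumes "derivation L NK \<Delta> A"
  shows "derivable L D (mtrans ` \<Delta>) (Neg (Neg (mtrans A)))"
  using assms
proof (induction rule: derivation.induct)
  case (assumption A)
  then show ?case
    by (auto simp: derivable_neg_neg_iff[OF NegI_NegE_in_D]
        intro: derivable_refute_assumption[OF in_D(2), of "mtrans A"])
next
  case (raa A \<Delta> \<Delta>')
  \<comment> \<open>The hypothesis is a double negation of \<open>Bot\<close>, hence yields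
    \<open>Bot\<close> itself. Restoring the discharged \<open>Neg (mtrans A)\<close> then gives
    exactly the refutation form of the goal.\<close>
  have "derivable L D (mtrans ` \<Delta>) Bot"
    using raa.IH derivable_neg_neg_Bot[OF NegI_NegE_in_D] by simp
  then have "derivable L D (insert (Neg (mtrans A)) (mtrans ` \<Delta>')) Bot"
    by (rule derivable_weaken) (use discharge_superset[OF raa.hyps(4)] in auto)
  then show ?case
    using raa.hyps by (simp add: derivable_neg_neg_iff[OF NegI_NegE_in_D])
next
  case (efq A \<Delta>)
  \<comment> \<open>The case is void because \<open>EFQ\<close> is not in \<open>NK\<close>.\<close>
  then show ?case
    by (simp add: NK_def NM_def)
next
  case top_i
  have "derivable L D (insert (Neg Top) {}) Top"
    using derivation.top_i[OF in_D(3)] by (rule derivableI) simp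
  then show ?case
    by (auto simp: derivable_neg_neg_iff[OF NegI_NegE_in_D] intro: derivable_refute[OF in_D(2)])
next
  case (neg_i A \<Delta> \<Delta>')
  have "derivable L D (mtrans ` \<Delta>) Bot"
    using neg_i.IH derivable_neg_neg_Bot[OF NegI_NegE_in_D] by simp
  then have "derivable L D (insert (mtrans A) (mtrans ` \<Delta>')) Bot"
    by (rule derivable_weaken) (use discharge_superset[OF neg_i.hyps(4)] in auto)
  then have "derivable L D (mtrans ` \<Delta>') (Neg (mtrans A))"
    using neg_i.hyps by (auto intro: derivable_neg_i[OF in_D(1)])
  \<comment> \<open>From here \<open>Neg (mtrans A)\<close> is doubly negated: it contradicts the
    added assumption that is its negation.\<close>
  then have "derivable L D (insert (Neg (Neg (mtrans A))) (mtrans ` \<Delta>')) (Neg (mtrans A))"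
    by (rule derivable_weaken) blast
  then have "derivable L D (insert (Neg (Neg (mtrans A))) (mtrans ` \<Delta>')) Bot"
    using neg_i.hyps by (intro derivable_refute[OF in_D(2), of "Neg (mtrans A)"]) auto
  then show ?case
    using neg_i.hyps by (simp add: derivable_neg_neg_iff[OF NegI_NegE_in_D])
next
  case (neg_e \<Delta>1 A \<Delta>2)
  have fA: "is_formula L A"
    using derivation_is_formula[OF neg_e.hyps(3)] by simp_all
  let ?\<Gamma> = "mtrans ` (\<Delta>1 \<union> \<Delta>2)"
  \<comment> \<open>The first hypothesis is a triple negation. Collapsed to a single one, it
    contradicts the second hypothesis, \<open>Neg (Neg (mtrans A))\<close>, directly.\<close>
  have "derivable L D (mtrans ` \<Delta>1) (Neg (mtrans A))"
    by (rule derivable_neg_neg_neg[OF NegI_NegE_in_D]) (use neg_e.IH(1) fA in simp_all)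
  then have "derivable L D ?\<Gamma> (Neg (mtrans A))"
    by (rule derivable_weaken) blast
  moreover have "derivable L D ?\<Gamma> (Neg (Neg (mtrans A)))"
    using neg_e.IH(2) by (rule derivable_weaken) blast
  ultimately have "derivable L D ?\<Gamma> Bot"
    using derivable_neg_e[OF in_D(2)] by blast
  then have "derivable L D (insert (Neg Bot) ?\<Gamma>) Bot"
    by (rule derivable_weaken) blast
  then show ?case
    by (simp add: derivable_neg_neg_iff[OF NegI_NegE_in_D])
next
  case (imp_i A \<Delta> B \<Delta>')
  let ?C = "Disj (Neg (mtrans A)) (mtrans B)"
  let ?\<Gamma> = "insert (Neg ?C) (mtrans ` \<Delta>')"
  have f: "is_formula L A" "is_formula L B"
    using imp_i.hyps(2) derivation_is_formula[OF imp_i.hyps(3)] by simp_all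
  \<comment> \<open>As in the proof of the double negation of excluded middle, \<open>Neg ?C\<close>
    is used twice: under the assumption \<open>mtrans A\<close>, the right disjunct yields
    \<open>?C\<close> and a contradiction; this proves \<open>Neg (mtrans A)\<close>, which yields
    \<open>?C\<close> again as left disjunct.\<close>
  have B: "derivable L D (insert (mtrans B) (insert (mtrans A) ?\<Gamma>)) ?C"
    by (rule derivableI[OF derivation.disj_i2[OF in_D(8) _ assumption]]) (use f in auto)
  have "derivable L D (insert (mtrans A) ?\<Gamma>) Bot"
    by (rule D_neg_neg_bind[OF _ imp_i.IH])
      (use f B discharge_superset[OF imp_i.hyps(4)] in
        \<open>auto intro: derivable_refute[OF in_D(2), of ?C]\<close>)
  then have "derivable L D ?\<Gamma> (Neg (mtrans A))"
    using f by (auto intro: derivable_neg_i[OF in_D(1)])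
  then have "derivable L D ?\<Gamma> ?C"
    using f(2) by (intro derivable_disj_i1[OF in_D(7)]) simp
  then have "derivable L D ?\<Gamma> Bot"
    using f by (auto intro: derivable_refute[OF in_D(2), of ?C])
  then show ?case
    using f by (simp add: derivable_neg_neg_iff[OF NegI_NegE_in_D])
next
  case (imp_e \<Delta>1 A B \<Delta>2)
  let ?C = "Disj (Neg (mtrans A)) (mtrans B)"
  let ?\<Gamma> = "insert (Neg (mtrans B)) (mtrans ` (\<Delta>1 \<union> \<Delta>2))"
  have f: "is_formula L A" "is_formula L B"
    using derivation_is_formula[OF imp_e.hyps(2)] by simp_all
  \<comment> \<open>Case distinction on the translated implication: the left disjunct is refuted by
    the hypothesis on \<open>A\<close>, the right one by the \<open>Neg (mtrans B)\<close> in
    \<open>?\<Gamma>\<close>.\<close>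
  have "derivable L D (insert (Neg (mtrans A)) (insert ?C ?\<Gamma>)) Bot"
    by (rule D_neg_neg_bind[OF _ imp_e.IH(2)])
      (use f in \<open>auto intro: derivable_refute_assumption[OF in_D(2), of "mtrans A"]\<close>)
  moreover have "derivable L D (insert (mtrans B) (insert ?C ?\<Gamma>)) Bot"
    using f by (auto intro: derivable_refute_assumption[OF in_D(2), of "mtrans B"])
  moreover have "derivable L D (insert ?C ?\<Gamma>) ?C"
    using f by (auto intro: derivable_assumption)
  ultimately have "derivable L D (insert ?C ?\<Gamma>) Bot"
    by (rule derivable_disj_e[OF in_D(9), rotated])
  then have "derivable L D ?\<Gamma> Bot"
    by - (rule D_neg_neg_bind[OF _ imp_e.IH(1)], use f in auto)
  then show ?case
    using f by (simp add: derivable_neg_neg_iff[OF NegI_NegE_in_D])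
next
  case (conj_i \<Delta>1 A \<Delta>2 B)
  let ?C = "Conj (mtrans A) (mtrans B)"
  let ?\<Gamma> = "insert (Neg ?C) (mtrans ` (\<Delta>1 \<union> \<Delta>2))"
  have f: "is_formula L A" "is_formula L B"
    using derivation_is_formula[OF conj_i.hyps(2)] derivation_is_formula[OF conj_i.hyps(3)] by simp_all
  have "derivation L D ({mtrans A} \<union> {mtrans B}) ?C"
    using f by (intro derivation.conj_i[OF in_D(4)] assumption) auto
  then have "derivable L D (insert (mtrans B) (insert (mtrans A) ?\<Gamma>)) ?C"
    by (rule derivableI) blast
  then have "derivable L D (insert (mtrans B) (insert (mtrans A) ?\<Gamma>)) Bot"
    using f by (auto intro: derivable_refute[OF in_D(2), of ?C])
  then have "derivable L D (insert (mtrans A) ?\<Gamma>) Bot"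
    by - (rule D_neg_neg_bind[OF _ conj_i.IH(2)], use f in auto)
  then have "derivable L D ?\<Gamma> Bot"
    by - (rule D_neg_neg_bind[OF _ conj_i.IH(1)], use f in auto)
  then show ?case
    using f by (simp add: derivable_neg_neg_iff[OF NegI_NegE_in_D])
next
  case (conj_e1 \<Delta> A B)
  let ?C = "Conj (mtrans A) (mtrans B)"
  let ?\<Gamma> = "insert (Neg (mtrans A)) (mtrans ` \<Delta>)"
  have f: "is_formula L A" "is_formula L B"
    using derivation_is_formula[OF conj_e1.hyps(2)] by simp_all
  have "derivable L D (insert ?C ?\<Gamma>) (mtrans A)"
    by (rule derivableI[OF derivation.conj_e1[OF in_D(5) assumption, of L "mtrans A" "mtrans B"]]) (use f in auto)
  then have "derivable L D (insert ?C ?\<Gamma>) Bot"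
    using f by (auto intro: derivable_refute[OF in_D(2), of "mtrans A"])
  then have "derivable L D ?\<Gamma> Bot"
    by - (rule D_neg_neg_bind[OF _ conj_e1.IH], use f in auto)
  then show ?case
    using f by (simp add: derivable_neg_neg_iff[OF NegI_NegE_in_D])
next
  case (conj_e2 \<Delta> A B)
  let ?C = "Conj (mtrans A) (mtrans B)"
  let ?\<Gamma> = "insert (Neg (mtrans B)) (mtrans ` \<Delta>)"
  have f: "is_formula L A" "is_formula L B"
    using derivation_is_formula[OF conj_e2.hyps(2)] by simp_all
  have "derivable L D (insert ?C ?\<Gamma>) (mtrans B)"
    by (rule derivableI[OF derivation.conj_e2[OF in_D(6) assumption, of L "mtrans A" "mtrans B"]]) (use f in auto)
  then have "derivable L D (insert ?C ?\<Gamma>) Bot"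
    using f by (auto intro: derivable_refute[OF in_D(2), of "mtrans B"])
  then have "derivable L D ?\<Gamma> Bot"
    by - (rule D_neg_neg_bind[OF _ conj_e2.IH], use f in auto)
  then show ?case
    using f by (simp add: derivable_neg_neg_iff[OF NegI_NegE_in_D])
next
  case (disj_i1 B \<Delta> A)
  let ?C = "Disj (mtrans A) (mtrans B)"
  let ?\<Gamma> = "insert (Neg ?C) (mtrans ` \<Delta>)"
  have f: "is_formula L A" "is_formula L B"
    using disj_i1.hyps(2) derivation_is_formula[OF disj_i1.hyps(3)] by simp_all
  have "derivable L D (insert (mtrans A) ?\<Gamma>) ?C"
    by (rule derivableI[OF derivation.disj_i1[OF in_D(7) _ assumption]]) (use f in auto)
  then have "derivable L D (insert (mtrans A) ?\<Gamma>) Bot"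
    using f by (auto intro: derivable_refute[OF in_D(2), of ?C])
  then have "derivable L D ?\<Gamma> Bot"
    by - (rule D_neg_neg_bind[OF _ disj_i1.IH], use f in auto)
  then show ?case
    using f by (simp add: derivable_neg_neg_iff[OF NegI_NegE_in_D])
next
  case (disj_i2 A \<Delta> B)
  let ?C = "Disj (mtrans A) (mtrans B)"
  let ?\<Gamma> = "insert (Neg ?C) (mtrans ` \<Delta>)"
  have f: "is_formula L A" "is_formula L B"
    using disj_i2.hyps(2) derivation_is_formula[OF disj_i2.hyps(3)] by simp_all
  have "derivable L D (insert (mtrans B) ?\<Gamma>) ?C"
    by (rule derivableI[OF derivation.disj_i2[OF in_D(8) _ assumption]]) (use f in auto)
  then have "derivable L D (insert (mtrans B) ?\<Gamma>) Bot"
    using f by (auto intro: derivable_refute[OF in_D(2), of ?C])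
  then have "derivable L D ?\<Gamma> Bot"
    by - (rule D_neg_neg_bind[OF _ disj_i2.IH], use f in auto)
  then show ?case
    using f by (simp add: derivable_neg_neg_iff[OF NegI_NegE_in_D])
next
  case (disj_e \<Delta> A B \<Delta>1 C \<Delta>1' \<Delta>2 \<Delta>2')
  let ?E = "Disj (mtrans A) (mtrans B)"
  let ?\<Gamma> = "insert (Neg (mtrans C)) (mtrans ` (\<Delta> \<union> \<Delta>1' \<union> \<Delta>2'))"
  have f: "is_formula L A" "is_formula L B" "is_formula L C"
    using derivation_is_formula[OF disj_e.hyps(2)] derivation_is_formula[OF disj_e.hyps(3)] by simp_all
  \<comment> \<open>With \<open>Neg (mtrans C)\<close> in the context both minor premises end in
    \<open>Bot\<close>, so the disjunction is eliminated towards \<open>Bot\<close> and only then is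
    its double negation unwrapped.\<close>
  have "derivable L D (insert (Neg (mtrans C)) (mtrans ` \<Delta>1)) Bot"
    using disj_e.IH(2) f by (simp add: derivable_neg_neg_iff[OF NegI_NegE_in_D])
  then have "derivable L D (insert (mtrans A) (insert ?E ?\<Gamma>)) Bot"
    by (rule derivable_weaken) (use discharge_superset[OF disj_e.hyps(4)] in auto)
  moreover have "derivable L D (insert (Neg (mtrans C)) (mtrans ` \<Delta>2)) Bot"
    using disj_e.IH(3) f by (simp add: derivable_neg_neg_iff[OF NegI_NegE_in_D])
  then have "derivable L D (insert (mtrans B) (insert ?E ?\<Gamma>)) Bot"
    by (rule derivable_weaken) (use discharge_superset[OF disj_e.hyps(6)] in auto)
  moreover have "derivable L D (insert ?E ?\<Gamma>) ?E"
    using f by (auto intro: derivable_assumption)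
  ultimately have "derivable L D (insert ?E ?\<Gamma>) Bot"
    by (rule derivable_disj_e[OF in_D(9), rotated])
  then have "derivable L D ?\<Gamma> Bot"
    by - (rule D_neg_neg_bind[OF _ disj_e.IH(1)], use f in auto)
  then show ?case
    using f by (simp add: derivable_neg_neg_iff[OF NegI_NegE_in_D])
next
  case (forall_i \<Delta> A y)
  let ?E = "Exists (Neg (mtrans A))"
  have f: "is_formula L A"
    using derivation_is_formula[OF forall_i.hyps(2)] by simp
  have "derivable L D (insert ?E (mtrans ` \<Delta>)) ?E"
    using f by (auto intro: derivable_assumption)
  \<comment> \<open>The hypothesis, a double negation of the instance at \<open>y\<close>, is just a
    refutation of its negation. This is the minor premise for eliminating \<open>?E\<close> with the
    same eigenvariable; its side conditions carry over because \<open>mtrans\<close> preserves free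
    variables.\<close>
  moreover have "derivable L D (insert (inst (Neg (mtrans A)) (Var y)) (mtrans ` \<Delta>)) Bot"
    using forall_i.IH f by (simp add: derivable_neg_neg_iff[OF NegI_NegE_in_D])
  ultimately have "derivable L D (insert ?E (mtrans ` \<Delta>)) Bot"
    by (rule derivable_exists_e[OF in_D(11)]) (use forall_i.hyps in auto)
  then have "derivable L D (mtrans ` \<Delta>) (Neg ?E)"
    using f by (auto intro: derivable_neg_i[OF in_D(1)])
  then have "derivable L D (insert (Neg (Neg ?E)) (mtrans ` \<Delta>)) (Neg ?E)"
    by (rule derivable_weaken) blast
  then have "derivable L D (insert (Neg (Neg ?E)) (mtrans ` \<Delta>)) Bot"
    using f by (intro derivable_refute[OF in_D(2), of "Neg ?E"]) auto
  then show ?case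
    using f by (simp add: derivable_neg_neg_iff[OF NegI_NegE_in_D])
next
  case (forall_e t \<Delta> A)
  let ?E = "Exists (Neg (mtrans A))"
  let ?\<Gamma> = "insert (Neg (inst (mtrans A) t)) (mtrans ` \<Delta>)"
  have f: "is_formula L A"
    using derivation_is_formula[OF forall_e.hyps(3)] by simp
  \<comment> \<open>The term \<open>t\<close> witnesses \<open>?E\<close>, as
    \<open>?\<Gamma>\<close> contains the negated instance at \<open>t\<close>.\<close>
  have "derivable L D (insert (Neg ?E) ?\<Gamma>) ?E"
    by (rule derivableI[OF derivation.exists_i[OF in_D(10) forall_e.hyps(2) assumption]])
      (use f forall_e.hyps(2) in auto)
  then have "derivable L D (insert (Neg ?E) ?\<Gamma>) Bot"
    using f by (auto intro: derivable_refute[OF in_D(2), of ?E])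
  then have "derivable L D ?\<Gamma> Bot"
    by - (rule D_neg_neg_bind[OF _ forall_e.IH], use f in auto)
  then show ?case
    using f forall_e.hyps(2) by (simp add: derivable_neg_neg_iff[OF NegI_NegE_in_D])
next
  case (exists_i t \<Delta> A)
  let ?C = "Exists (mtrans A)"
  let ?\<Gamma> = "insert (Neg ?C) (mtrans ` \<Delta>)"
  have f: "is_formula L A"
    using derivation_is_formula[OF exists_i.hyps(3)] exists_i.hyps(2) by simp
  have "derivable L D (insert (inst (mtrans A) t) ?\<Gamma>) ?C"
    by (rule derivableI[OF derivation.exists_i[OF in_D(10) exists_i.hyps(2) assumption]])
      (use f exists_i.hyps(2) in auto)
  then have "derivable L D (insert (inst (mtrans A) t) ?\<Gamma>) Bot"
    using f by (auto intro: derivable_refute[OF in_D(2), of ?C])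
  then have "derivable L D ?\<Gamma> Bot"
    by - (rule D_neg_neg_bind[OF _ exists_i.IH], use f exists_i.hyps(2) in auto)
  then show ?case
    using f by (simp add: derivable_neg_neg_iff[OF NegI_NegE_in_D])
next
  case (exists_e \<Delta>1 A \<Delta>2 C \<Delta>2' y)
  let ?E = "Exists (mtrans A)"
  \<comment> \<open>The eigenvariable \<open>y\<close> may be free in \<open>\<Delta>1\<close>, so
    the minor premise is kept over \<open>\<Delta>2'\<close> alone. Adding
    \<open>Neg (mtrans C)\<close> is harmless since \<open>y\<close> is not free in
    \<open>C\<close>.\<close>
  let ?\<Gamma>2 = "insert (Neg (mtrans C)) (mtrans ` \<Delta>2')"
  let ?\<Gamma> = "insert (Neg (mtrans C)) (mtrans ` (\<Delta>1 \<union> \<Delta>2'))"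
  have f: "is_formula L A" "is_formula L C"
    using derivation_is_formula[OF exists_e.hyps(2)] derivation_is_formula[OF exists_e.hyps(3)] by simp_all
  have "derivable L D (insert (Neg (mtrans C)) (mtrans ` \<Delta>2)) Bot"
    using exists_e.IH(2) f by (simp add: derivable_neg_neg_iff[OF NegI_NegE_in_D])
  moreover have "mtrans ` \<Delta>2 \<subseteq> mtrans ` insert (inst A (Var y)) \<Delta>2'"
    using discharge_superset[OF exists_e.hyps(4)] by (rule image_mono)
  then have "insert (Neg (mtrans C)) (mtrans ` \<Delta>2) \<subseteq> insert (inst (mtrans A) (Var y)) ?\<Gamma>2"
    by auto
  ultimately have 2: "derivable L D (insert (inst (mtrans A) (Var y)) ?\<Gamma>2) Bot"
    by (rule derivable_weaken)
  have "derivable L D (insert ?E ?\<Gamma>) ?E"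
    using f by (auto intro: derivable_assumption)
  then have "derivable L D (insert ?E ?\<Gamma>) Bot"
    using 2 by (rule derivable_exists_e[OF in_D(11)]) (use exists_e.hyps in auto)
  then have "derivable L D ?\<Gamma> Bot"
    by - (rule D_neg_neg_bind[OF _ exists_e.IH(1)], use f in auto)
  then show ?case
    using f by (simp add: derivable_neg_neg_iff[OF NegI_NegE_in_D])
qed

section \<open>From derivations to derivability, and formulas without implication and universal
  quantifier\<close>

lemma derivable_NK_mtrans:
  "derivable L NK \<Gamma> A \<Longrightarrow> derivable L D (mtrans ` \<Gamma>) (Neg (Neg (mtrans A)))"
  by (metis derivable_def derivable_weaken derivation_NK_mtrans image_mono)

theorem theorem6p4:
  fixes L :: "('f, 'p) language"
    and \<Gamma> :: "('f, 'p) fm set"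
    and A :: "('f, 'p) fm"
  assumes "\<forall>B \<in> \<Gamma>. is_formula L B"
    and "is_formula L A"
  shows "(derivable L NK \<Gamma> A \<longrightarrow>
            derivable L (NM - {ImpI, ImpE, ForallI, ForallE}) (mtrans ` \<Gamma>) (Neg (Neg (mtrans A))) \<and>
            derivable L (NM - {ImpI, ImpE, ForallI, ForallE})
              (insert (Neg (mtrans A)) (mtrans ` \<Gamma>)) Bot)
       \<and> (imp_forall_free A \<and> (\<forall>B \<in> \<Gamma>. imp_forall_free B) \<longrightarrow>
            (derivable L NK \<Gamma> A \<longleftrightarrow> derivable L NM \<Gamma> (Neg (Neg A))) \<and>
            (derivable L NM \<Gamma> (Neg (Neg A)) \<longleftrightarrow> derivable L NM (insert (Neg A) \<Gamma>) Bot) \<and>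
            (\<forall>B. A = Neg B \<longrightarrow> (derivable L NK \<Gamma> (Neg B) \<longleftrightarrow> derivable L NM \<Gamma> (Neg B))))"
proof (intro conjI impI; (elim conjE)?)
  assume "derivable L NK \<Gamma> A"
  then show *: "derivable L D (mtrans ` \<Gamma>) (Neg (Neg (mtrans A)))"
    by (rule derivable_NK_mtrans)
  then show "derivable L D (insert (Neg (mtrans A)) (mtrans ` \<Gamma>)) Bot"
    using assms(2) by (simp add: derivable_neg_neg_iff[OF NegI_NegE_in_D])
next
  assume free: "imp_forall_free A" "\<forall>B \<in> \<Gamma>. imp_forall_free B"
  have NM: "{NegI, NegE} \<subseteq> NM" and NK: "{NegI, NegE} \<subseteq> NK" "RAA \<in> NK" "NM \<subseteq> NK"
    by (auto simp: NM_def NK_def)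
  \<comment> \<open>Here the translation is the identity on \<open>A\<close> and on \<Gamma>, and
    \<open>D\<close> is contained in \<open>NM\<close>.\<close>
  have to_NM: "derivable L NM \<Gamma> (Neg (Neg A))" if "derivable L NK \<Gamma> A"
  proof -
    have "mtrans ` \<Gamma> = \<Gamma>"
      using free(2) by (simp add: mtrans_imp_forall_free)
    then have "derivable L D \<Gamma> (Neg (Neg A))"
      using derivable_NK_mtrans[OF that] free(1) by (simp add: mtrans_imp_forall_free)
    then show ?thesis
      by (rule derivable_mono_rules) auto
  qed
  show "derivable L NK \<Gamma> A \<longleftrightarrow> derivable L NM \<Gamma> (Neg (Neg A))"
  proof
    assume "derivable L NM \<Gamma> (Neg (Neg A))"
    then have "derivable L NK \<Gamma> (Neg (Neg A))"
      using NK(3) by (rule derivable_mono_rules)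
    \<comment> \<open>Inside \<open>NK\<close> the double negation is a derivation of
      \<open>Bot\<close> from \<open>Neg A\<close>, to which \<open>raa\<close> applies.\<close>
    then show "derivable L NK \<Gamma> A"
      using assms(2) NK by (simp add: derivable_neg_neg_iff derivable_raa)
  qed (rule to_NM)
  show "derivable L NM \<Gamma> (Neg (Neg A)) \<longleftrightarrow> derivable L NM (insert (Neg A) \<Gamma>) Bot"
    using NM assms(2) by (rule derivable_neg_neg_iff)
  show "\<forall>B. A = Neg B \<longrightarrow> (derivable L NK \<Gamma> (Neg B) \<longleftrightarrow> derivable L NM \<Gamma> (Neg B))"
  proof (intro allI impI iffI)
    fix B
    assume A: "A = Neg B"
    \<comment> \<open>For \<open>A = Neg B\<close> the double negation obtained from
      \<open>to_NM\<close> is a triple negation of \<open>B\<close>, which collapses in minimal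
      logic.\<close>
    show "derivable L NM \<Gamma> (Neg B)" if "derivable L NK \<Gamma> (Neg B)"
      by (rule derivable_neg_neg_neg[OF NM]) (use that to_NM assms(2) A in simp_all)
    show "derivable L NK \<Gamma> (Neg B)" if "derivable L NM \<Gamma> (Neg B)"
      using that NK(3) by (rule derivable_mono_rules)
  qed
qed

end
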